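(* Let $A$ be a finite-dimensional semisimple Leibniz algebra over an algebraically closed field $\mathbb{F}$ of characteristic zero. Then the Killing form $\kappa(\,,\,)$ on $A$ is nondegenerate, in the sense that $A^{\perp}=\mathrm{Leib}(A)$.
   Context: A (left) Leibniz algebra over $\mathbb{F}$ is an $\mathbb{F}$-vector space $A$ with a bilinear map $[\,,\,]:A\times A\to A$ satisfying $[a,[b,c]]=[[a,b],c]+[b,[a,c]]$ for all $a,b,c\in A$. For $a\in A$, $L_a:A\to A$ is $L_a(b)=[a,b]$. $\mathrm{Leib}(A)=\mathrm{span}\{[a,a]\mid a\in A\}$, which is an ideal of $A$; an ideal is a subspace $I$ with $[A,I]\subseteq I$ and $[I,A]\subseteq I$. The derived series of a Leibniz algebra $B$ is $B^{(0)}=B$, $B^{(i+1)}=[B^{(i)},B^{(i)}]$ (spans of products), and $B$ is solvable if $B^{(m)}=0$ for some $m\ge0$. $\mathrm{rad}(A)$ is the unique maximal solvable ideal of $A$ (it contains all solvable ideals). $A$ is semisimple if $\mathrm{rad}(A)=\mathrm{Leib}(A)$. The Killing form is $\kappa:A\times A\to\mathbb{F}$, $\kappa(a,b)=\mathrm{tr}(L_aL_b)$, and its radical is $A^{\perp}=\{b\in A\mid \kappa(b,a)=0\text{ for all }a\in A\}$. The Killing form of a Leibniz algebra $A$ is called nondegenerate if $A^{\perp}=\mathrm{Leib}(A)$. *)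

theory Defs
  imports "HOL-Computational_Algebra.Computational_Algebra"
begin

text \<open>The underlying vector space is the whole type \<open>'b\<close>; the scalars form the field type \<open>'a\<close>.\<close>

locale leibniz_algebra = vector_space scale
  for scale :: "'a::field \<Rightarrow> 'b::ab_group_add \<Rightarrow> 'b" (infixr \<open>*s\<close> 75) +
  fixes bracket :: "'b \<Rightarrow> 'b \<Rightarrow> 'b"
  assumes linear_bracket_left: "Vector_Spaces.linear scale scale (\<lambda>a. bracket a b)"
    and linear_bracket_right: "Vector_Spaces.linear scale scale (\<lambda>b. bracket a b)"
    and leibniz: "bracket a (bracket b c) = bracket (bracket a b) c + bracket b (bracket a c)"
begin

definition trace_wrt :: "'b set \<Rightarrow> ('b \<Rightarrow> 'b) \<Rightarrow> 'a" where
  "trace_wrt B f = (\<Sum>b\<in>B. representation B (f b) b)"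

lemma trace_wrt_basis_independent:
  assumes f: "Vector_Spaces.linear scale scale f"
    and B: "finite B" "independent B" "span B = UNIV"
    and C: "finite C" "independent C" "span C = UNIV"
  shows "trace_wrt B f = trace_wrt C f"
proof -
  interpret f: Vector_Spaces.linear scale scale f by (rule f)
  have f_exp: "f b = (\<Sum>c\<in>C. representation C b c *s f c)" for b
  proof -
    have "f b = f (\<Sum>c\<in>C. representation C b c *s c)"
      using sum_representation_eq[of C b C] C by simp
    then show ?thesis by (simp add: f.sum f.scale)
  qed
  have rep_sum: "representation D (\<Sum>i\<in>I. r i *s g i) d = (\<Sum>i\<in>I. r i * representation D (g i) d)"
    if "independent D" "span D = UNIV" for D d r and I :: "'b set" and g
    using that by (simp add: representation_sum representation_scale)
  have "trace_wrt B f = (\<Sum>b\<in>B. \<Sum>c\<in>C. representation C b c * representation B (f c) b)"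
    unfolding trace_wrt_def by (subst f_exp) (simp add: rep_sum B)
  also have "\<dots> = (\<Sum>c\<in>C. \<Sum>b\<in>B. representation B (f c) b * representation C b c)"
    by (subst sum.swap) (simp add: mult.commute)
  also have "\<dots> = (\<Sum>c\<in>C. representation C (\<Sum>b\<in>B. representation B (f c) b *s b) c)"
    by (simp add: rep_sum C)
  also have "\<dots> = trace_wrt C f"
    unfolding trace_wrt_def
    using sum_representation_eq[of B _ B] B by simp
  finally show ?thesis .
qed

definition Leib :: "'b set" where
  "Leib = span {bracket a a | a. True}"

definition is_ideal :: "'b set \<Rightarrow> bool" where
  "is_ideal I \<longleftrightarrow> subspace I \<and> (\<forall>a. \<forall>x\<in>I. bracket a x \<in> I \<and> bracket x a \<in> I)"

primrec derived_series :: "'b set \<Rightarrow> nat \<Rightarrow> 'b set" where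
  "derived_series B 0 = B"
| "derived_series B (Suc i) =
     span {bracket x y | x y. x \<in> derived_series B i \<and> y \<in> derived_series B i}"

definition solvable :: "'b set \<Rightarrow> bool" where
  "solvable B \<longleftrightarrow> (\<exists>m. derived_series B m = {0})"

text \<open>The greatest solvable ideal. It exists in finite dimension; see \<open>rad_greatest\<close> below.\<close>

definition rad :: "'b set" where
  "rad = (THE R. is_ideal R \<and> solvable R \<and> (\<forall>I. is_ideal I \<and> solvable I \<longrightarrow> I \<subseteq> R))"

definition semisimple :: bool where
  "semisimple \<longleftrightarrow> rad = Leib"

lemma bracket_add_left: "bracket (a + b) c = bracket a c + bracket b c"
proof -
  interpret l: Vector_Spaces.linear scale scale "\<lambda>a. bracket a c" by (rule linear_bracket_left)
  show ?thesis by (rule l.add)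
qed

lemma bracket_add_right: "bracket a (b + c) = bracket a b + bracket a c"
proof -
  interpret l: Vector_Spaces.linear scale scale "\<lambda>b. bracket a b" by (rule linear_bracket_right)
  show ?thesis by (rule l.add)
qed

lemma bracket_zero_left: "bracket 0 c = 0"
  using bracket_add_left[of 0 0 c] by simp

lemma bracket_zero_right: "bracket c 0 = 0"
  using bracket_add_right[of c 0 0] by simp

lemma derived_series_mono: "B \<subseteq> C \<Longrightarrow> derived_series B n \<subseteq> derived_series C n"
proof (induction n)
  case (Suc n)
  then have "derived_series B n \<subseteq> derived_series C n" by simp
  then show ?case by (auto intro!: span_mono)
qed simp

lemma derived_series_add: "derived_series B (m + n) = derived_series (derived_series B m) n"
  by (induction n) auto

lemma subspace_derived_series: "subspace B \<Longrightarrow> subspace (derived_series B n)"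
  by (cases n) auto

lemma is_ideal_sum:
  assumes I: "is_ideal I" and J: "is_ideal J"
  shows "is_ideal {x + y | x y. x \<in> I \<and> y \<in> J}" (is "is_ideal ?S")
proof -
  have "bracket a z \<in> ?S \<and> bracket z a \<in> ?S" if z: "z \<in> ?S" for a z
  proof -
    obtain x y where "z = x + y" "x \<in> I" "y \<in> J" using z by blast
    then have "bracket a z = bracket a x + bracket a y" "bracket z a = bracket x a + bracket y a"
      "bracket a x \<in> I" "bracket a y \<in> J" "bracket x a \<in> I" "bracket y a \<in> J"
      using I J by (auto simp: is_ideal_def bracket_add_left bracket_add_right)
    then show ?thesis by blast
  qed
  then show ?thesis using I J subspace_sums[of I J] unfolding is_ideal_def by blast
qed

lemma solvable_sum:
  assumes I: "is_ideal I" "solvable I" and J: "is_ideal J" "solvable J"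
  shows "solvable {x + y | x y. x \<in> I \<and> y \<in> J}"
proof -
  let ?S = "{x + y | x y. x \<in> I \<and> y \<in> J}"
  obtain m k where m: "derived_series I m = {0}" and k: "derived_series J k = {0}"
    using I J unfolding solvable_def by auto
  have sub: "subspace I" "subspace J" using I J by (auto simp: is_ideal_def)
  have step: "derived_series ?S n \<subseteq> {x + y | x y. x \<in> derived_series I n \<and> y \<in> J}" for n
  proof (induction n)
    case (Suc n)
    let ?T = "{x + y | x y. x \<in> derived_series I (Suc n) \<and> y \<in> J}"
    have "subspace ?T"
      using subspace_sums subspace_derived_series sub by blast
    moreover have "bracket u v \<in> ?T" if uv: "u \<in> derived_series ?S n" "v \<in> derived_series ?S n" for u v
    proof -
      obtain x p where u: "u = x + p" "x \<in> derived_series I n" "p \<in> J" using Suc uv by blast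
      obtain y q where v: "v = y + q" "y \<in> derived_series I n" "q \<in> J" using Suc uv by blast
      have "bracket u v = bracket x y + (bracket x q + (bracket p y + bracket p q))"
        unfolding u v by (simp add: bracket_add_left bracket_add_right algebra_simps)
      moreover have "bracket x y \<in> derived_series I (Suc n)"
        using u v by (auto intro!: span_base)
      moreover have "bracket x q + (bracket p y + bracket p q) \<in> J"
        using J u v by (auto simp: is_ideal_def intro!: subspace_add)
      ultimately show ?thesis by blast
    qed
    ultimately show ?case
      unfolding derived_series.simps(2)[of ?S] by (intro span_minimal) blast+
  qed simp
  have "derived_series ?S m \<subseteq> J" using step[of m] m by auto
  then have "derived_series ?S (m + k) \<subseteq> {0}"
    using derived_series_mono[of _ J k] k by (simp add: derived_series_add)
  moreover have "0 \<in> derived_series ?S (m + k)"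
    by (intro subspace_0 subspace_derived_series subspace_sums sub)
  ultimately show ?thesis unfolding solvable_def by blast
qed

end

locale finite_dimensional_leibniz_algebra =
  leibniz_algebra scale bracket + finite_dimensional_vector_space scale Basis
  for scale :: "'a::field \<Rightarrow> 'b::ab_group_add \<Rightarrow> 'b" (infixr \<open>*s\<close> 75)
    and bracket :: "'b \<Rightarrow> 'b \<Rightarrow> 'b"
    and Basis :: "'b set"
begin

lemma rad_greatest:
  shows "is_ideal rad \<and> solvable rad \<and> (\<forall>I. is_ideal I \<and> solvable I \<longrightarrow> I \<subseteq> rad)"
proof -
  let ?P = "\<lambda>I. is_ideal I \<and> solvable I"
  have "derived_series {0} 0 = {0}" by simp
  then have "solvable {0}"
    unfolding solvable_def by (rule exI)
  then have zero: "?P {0}"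
    unfolding is_ideal_def by (simp add: bracket_zero_left bracket_zero_right)
  have "\<forall>I. ?P I \<longrightarrow> dim I \<le> dimension"
    using dim_subset_UNIV by simp
  then obtain R where R: "?P R" and "\<forall>I. ?P I \<longrightarrow> dim I \<le> dim R"
    using ex_has_greatest_nat[of ?P "{0}" dim "Suc dimension"] zero by (auto simp: less_Suc_eq_le)
  then have max: "dim I \<le> dim R" if "?P I" for I
    using that by blast
  have sub: "I \<subseteq> R" if I: "?P I" for I
  proof -
    let ?S = "{x + y | x y. x \<in> R \<and> y \<in> I}"
    have S: "?P ?S" using R I is_ideal_sum solvable_sum by simp
    have z: "0 \<in> R" "0 \<in> I" using R I by (auto simp: is_ideal_def subspace_0)
    have "R \<subseteq> ?S" "I \<subseteq> ?S" using z by force+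
    moreover have "R = ?S"
      using subspace_dim_equal[of R ?S] R S max[OF S] \<open>R \<subseteq> ?S\<close> by (simp add: is_ideal_def)
    ultimately show ?thesis by simp
  qed
  show ?thesis
    unfolding rad_def by (rule theI[where a = R]) (use R sub in blast)+
qed

text \<open>\<open>bracket a\<close> is the left multiplication \<open>L\<^sub>a\<close>. By \<open>trace_wrt_basis_independent\<close> the
  Killing form does not depend on \<open>Basis\<close>.\<close>

definition killing_form :: "'b \<Rightarrow> 'b \<Rightarrow> 'a" where
  "killing_form a b = trace_wrt Basis (bracket a \<circ> bracket b)"

definition killing_radical :: "'b set" where
  "killing_radical = {b. \<forall>a. killing_form b a = 0}"

definition killing_nondegenerate :: bool where
  "killing_nondegenerate \<longleftrightarrow> killing_radical = Leib"

end

end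

theory Submission
  imports Defs
begin

text \<open>Left multiplication by an element of \<open>Leib\<close> is zero, so \<open>Leib\<close> lies in the Killing radical \<open>I\<close>.
  Conversely \<open>I\<close> is an ideal, and it suffices to see that it is solvable, since then
  \<open>I \<subseteq> rad = Leib\<close>.

  For a derivation \<open>y\<close> and \<open>u \<in> I\<close> one has
  \<open>tr (L\<^bsub>[u,w]\<^esub> y) = tr (L\<^sub>u [L\<^sub>w, y]) = - \<kappa>(u, y w) = 0\<close>, hence \<open>tr (L\<^sub>x y) = 0\<close> for \<open>x \<in> [I, I]\<close>.
  The generalised eigenspaces of \<open>L\<^sub>x\<close> grade the algebra by the additive group of the field, so every
  \<open>\<rat>\<close>-linear functional \<open>f\<close> on the field gives a derivation acting as \<open>f l\<close> on the \<open>l\<close>-eigenspace.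
  The trace is then the sum of the \<open>f(l) l\<close> over the eigenvalues \<open>l\<close>; applying \<open>f\<close>, the squares
  \<open>f(l)\<^sup>2\<close> sum to zero. Hence all eigenvalues vanish and \<open>L\<^sub>x\<close> is nilpotent. By Engel's theorem the
  stable term of the derived series of \<open>I\<close>, being perfect, is zero.\<close>

subsection \<open>Triangular bases of generalised eigenvectors\<close>

locale endomorphism = finite_dimensional_vector_space scale Basis + T: Vector_Spaces.linear scale scale T
  for scale :: "'a::field \<Rightarrow> 'b::ab_group_add \<Rightarrow> 'b" (infixr \<open>*s\<close> 75)
    and Basis :: "'b set" and T :: "'b \<Rightarrow> 'b"
begin

lemma linear_shift: "Vector_Spaces.linear scale scale (\<lambda>v. T v - c *s v)"
  by unfold_locales (simp_all add: T.add T.scale algebra_simps)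

section \<open>Polynomials in an endomorphism, evaluated at a vector by Horner's scheme\<close>

definition poly_apply :: "'a poly \<Rightarrow> 'b \<Rightarrow> 'b" where
  "poly_apply p u = fold_coeffs (\<lambda>a w. a *s u + T w) p 0"

lemma poly_apply_0 [simp]: "poly_apply 0 u = 0"
  by (simp add: poly_apply_def)

lemma poly_apply_pCons [simp]: "poly_apply (pCons a p) u = a *s u + T (poly_apply p u)"
  by (cases "a = 0 \<and> p = 0") (auto simp: poly_apply_def)

lemma poly_apply_add: "poly_apply (p + q) u = poly_apply p u + poly_apply q u"
  by (induction p q rule: poly_induct2) (simp_all add: T.add algebra_simps)

lemma poly_apply_smult: "poly_apply (smult c p) u = c *s poly_apply p u"
  by (induction p) (simp_all add: T.scale algebra_simps)

lemma poly_apply_sum: "poly_apply (\<Sum>i\<in>I. p i) u = (\<Sum>i\<in>I. poly_apply (p i) u)"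
  by (induction I rule: infinite_finite_induct) (simp_all add: poly_apply_add)

lemma poly_apply_linear_factor:
  "poly_apply ([:- c, 1:] * q) u = T (poly_apply q u) - c *s poly_apply q u"
proof -
  have "[:- c, 1:] * q = smult (- c) q + pCons 0 q" by simp
  then show ?thesis by (simp only: poly_apply_add poly_apply_smult poly_apply_pCons) simp
qed

text \<open>The \<open>dimension + 1\<close> vectors u, T u, T^2 u, ... cannot be independent, and a
  linear relation among them is a polynomial.\<close>

lemma ex_annihilating_poly: "\<exists>p. p \<noteq> 0 \<and> poly_apply p u = 0"
proof (rule ccontr)
  assume "\<not> ?thesis"
  then have nz: "p = 0" if "poly_apply p u = 0" for p using that by blast
  let ?g = "\<lambda>i. poly_apply (monom 1 i) u" and ?I = "{..dimension}"
  have coeff_zero: "c i = 0" if "(\<Sum>i\<in>?I. c i *s ?g i) = 0" "i \<in> ?I" for c i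
  proof -
    have "poly_apply (\<Sum>i\<in>?I. smult (c i) (monom 1 i)) u = 0"
      using that by (simp only: poly_apply_sum poly_apply_smult)
    then have "coeff (\<Sum>i\<in>?I. smult (c i) (monom 1 i)) i = 0"
      using nz by fastforce
    then have "(\<Sum>j\<in>?I. if j = i then c j else 0) = 0"
      by (simp add: coeff_sum if_distrib cong: if_cong)
    then show ?thesis using that(2) by (simp add: sum.delta)
  qed
  \<comment> \<open>Independence is a property of the set of these vectors, so it bounds their
    number only once they are known to be distinct.\<close>
  have inj: "inj_on ?g ?I"
  proof (rule inj_onI)
    fix i j assume "?g i = ?g j"
    then have "poly_apply (monom 1 i + smult (-1) (monom 1 j)) u = 0"
      by (simp only: poly_apply_add poly_apply_smult) simp
    then have "monom (1::'a) i + smult (-1) (monom 1 j) = 0" by (rule nz)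
    then have "monom (1::'a) i = monom 1 j" by (simp add: eq_neg_iff_add_eq_0 flip: smult_monom)
    then show "i = j" by (metis monom_eq_iff' zero_neq_one)
  qed
  have "independent (?g ` ?I)"
  proof (rule independent_if_scalars_zero)
    fix f x assume f: "(\<Sum>x\<in>?g ` ?I. f x *s x) = 0" and x: "x \<in> ?g ` ?I"
    have "(\<Sum>i\<in>?I. f (?g i) *s ?g i) = 0" using f by (simp add: sum.reindex[OF inj])
    then show "f x = 0" using coeff_zero[of "\<lambda>i. f (?g i)"] x by blast
  qed simp
  then have "card (?g ` ?I) \<le> dimension"
    using independent_card_le_dim[of _ UNIV] by (simp add: dimension_def)
  then show False by (simp add: card_image[OF inj])
qed

text \<open>The blocks of such a basis with equal value of \<open>lam\<close> span the generalised eigenspaces of \<open>T\<close>,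
  so it encodes the Jordan decomposition as far as it is needed. The order need not be injective.\<close>

definition triangular_basis :: "'b set \<Rightarrow> ('b \<Rightarrow> 'a) \<Rightarrow> ('b \<Rightarrow> nat) \<Rightarrow> bool" where
  "triangular_basis B lam ord \<longleftrightarrow> finite B \<and> independent B \<and>
    (\<forall>b\<in>B. T b - lam b *s b \<in> span {c \<in> B. ord c < ord b \<and> lam c = lam b})"

lemma triangular_basisD:
  assumes "triangular_basis B lam ord"
  shows "finite B" "independent B"
    and "\<And>b. b \<in> B \<Longrightarrow> T b - lam b *s b \<in> span {c \<in> B. ord c < ord b \<and> lam c = lam b}"
  using assms by (auto simp: triangular_basis_def)

text \<open>On a block with eigenvalue other than \<open>l\<close>, the map T - l is a nonzero
  scalar plus a part that lowers the order; preimages are found from the lowest order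
  upwards.\<close>

lemma shift_onto_other_eigenvalues:
  assumes B: "triangular_basis B lam ord" and w: "w \<in> span {b \<in> B. lam b \<noteq> l}"
  shows "\<exists>g\<in>span B. w = T g - l *s g"
proof -
  interpret S: Vector_Spaces.linear scale scale "\<lambda>v. T v - l *s v" by (rule linear_shift)
  let ?R = "(\<lambda>v. T v - l *s v) ` span B"
  have R: "subspace ?R" by (rule S.subspace_image) simp
  have "b \<in> ?R" if "b \<in> B" "lam b \<noteq> l" for b
    using that
  proof (induction "ord b" arbitrary: b rule: less_induct)
    case less
    let ?r = "T b - lam b *s b"
    have "{c \<in> B. ord c < ord b \<and> lam c = lam b} \<subseteq> ?R" using less by auto
    then have "?r \<in> ?R"
      using triangular_basisD(3)[OF B less.prems(1)] span_minimal[OF _ R] by (meson subsetD)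
    moreover have "T b - l *s b \<in> ?R" using less.prems span_base by blast
    ultimately have "(T b - l *s b) - ?r \<in> ?R" using R subspace_diff by blast
    moreover have "(T b - l *s b) - ?r = (lam b - l) *s b" by (simp add: algebra_simps)
    ultimately have "inverse (lam b - l) *s (lam b - l) *s b \<in> ?R"
      using subspace_scale[OF R, of "(lam b - l) *s b"] by simp
    then show ?case using less.prems by simp
  qed
  then have "span {b \<in> B. lam b \<noteq> l} \<subseteq> ?R" by (intro span_minimal R) blast
  then show ?thesis using w by blast
qed

lemma triangular_basis_extend:
  assumes B: "triangular_basis B lam ord" and v: "v \<notin> span B" "T v - l *s v \<in> span B"
  shows "\<exists>v lam' ord'. v \<notin> B \<and> triangular_basis (insert v B) lam' ord'"
proof -
  note fin = triangular_basisD(1)[OF B]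
  interpret S: Vector_Spaces.linear scale scale "\<lambda>v. T v - l *s v" by (rule linear_shift)
  have "B = {b \<in> B. lam b = l} \<union> {b \<in> B. lam b \<noteq> l}" by blast
  then obtain k w where kw: "T v - l *s v = k + w"
    "k \<in> span {b \<in> B. lam b = l}" "w \<in> span {b \<in> B. lam b \<noteq> l}"
    using v(2) span_Un[of "{b \<in> B. lam b = l}" "{b \<in> B. lam b \<noteq> l}"] by auto
  obtain g where g: "g \<in> span B" "w = T g - l *s g"
    using shift_onto_other_eigenvalues[OF B kw(3)] by blast
  let ?v = "v - g" \<comment> \<open>\<open>g\<close> removes the part of \<open>T v - l *s v\<close> outside the block of \<open>l\<close>\<close>
  have nv: "?v \<notin> span B" using v(1) g(1) span_add[of ?v B g] by auto
  then have nB: "?v \<notin> B" using span_base by blast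
  have Tv: "T ?v - l *s ?v = k" using kw(1) g(2) S.diff[of v g] by simp
  define lam' where "lam' = lam(?v := l)"
  \<comment> \<open>The new vector is ranked above all of \<open>B\<close>, so its remainder
    \<open>k\<close> may involve the whole block of \<open>l\<close>.\<close>
  define ord' where "ord' = ord(?v := Suc (Max (ord ` B)))"
  have same: "lam' b = lam b" "ord' b = ord b" if "b \<in> B" for b
    using that nB by (auto simp: lam'_def ord'_def)
  have "T b - lam' b *s b \<in> span {c \<in> insert ?v B. ord' c < ord' b \<and> lam' c = lam' b}"
    if "b \<in> insert ?v B" for b
  proof (cases "b = ?v")
    case True
    have "ord c < Suc (Max (ord ` B))" if "c \<in> B" for c
      using that fin by (simp add: less_Suc_eq_le)
    then have "{b \<in> B. lam b = l} \<subseteq> {c \<in> insert ?v B. ord' c < ord' b \<and> lam' c = lam' b}"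
      using True same nB by (auto simp: lam'_def ord'_def)
    then have "k \<in> span \<dots>" using kw(2) span_mono by blast
    then show ?thesis using True Tv by (simp add: lam'_def)
  next
    case False
    then have b: "b \<in> B" using that by blast
    have "{c \<in> B. ord c < ord b \<and> lam c = lam b}
        \<subseteq> {c \<in> insert ?v B. ord' c < ord' b \<and> lam' c = lam' b}"
      using same b by auto
    then have "T b - lam b *s b \<in> span \<dots>" using triangular_basisD(3)[OF B b] span_mono by blast
    then show ?thesis using same b by simp
  qed
  moreover have "independent (insert ?v B)"
    using independent_insertI[OF nv triangular_basisD(2)[OF B]] .
  ultimately have "triangular_basis (insert ?v B) lam' ord'"
    using fin unfolding triangular_basis_def by blast
  then show ?thesis using nB by blast
qed

text \<open>The remainder \<open>T c - lam c *s c\<close> is supported on strictly lower elements of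
  the block of \<open>c\<close>. The hypothesis on \<open>b\<close> excludes these, so only
  \<open>lam c *s c\<close> can contribute.\<close>

lemma representation_triangular:
  assumes B: "triangular_basis B lam ord" and c: "c \<in> B"
    and le: "ord c \<le> ord b \<or> lam c \<noteq> lam b"
  shows "representation B (T c) b = (if c = b then lam c else 0)"
proof -
  let ?L = "{x \<in> B. ord x < ord c \<and> lam x = lam c}"
  note ind = triangular_basisD(2)[OF B]
  have r: "T c - lam c *s c \<in> span ?L" by (rule triangular_basisD(3)[OF B c])
  have "representation B (T c - lam c *s c) b = representation ?L (T c - lam c *s c) b"
    using representation_extend[OF ind r] by (simp add: subset_iff)
  also have "\<dots> = 0" using le representation_ne_zero[of ?L _ b] by force
  finally have r0: "representation B (T c - lam c *s c) b = 0" .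
  have 1: "T c - lam c *s c \<in> span B" using r span_mono[of ?L B] by blast
  have 2: "lam c *s c \<in> span B" using c by (simp add: span_base span_scale)
  have "representation B ((T c - lam c *s c) + lam c *s c) b
      = representation B (T c - lam c *s c) b + representation B (lam c *s c) b"
    by (rule fun_cong[OF representation_add[OF ind 2 1]])
  then show ?thesis
    using r0 representation_scale[OF ind span_base[OF c]] representation_basis[OF ind c] by simp
qed

text \<open>Suppose \<open>v\<close> has components outside the block of \<open>l\<close>, and let
  \<open>b\<close> carry one of highest order. No other component reaches \<open>b\<close> under
  \<open>T\<close>, so the coefficient of \<open>T v - l *s v\<close> at \<open>b\<close> is
  \<open>lam b - l\<close> times that of \<open>v\<close>, which is nonzero.\<close>

lemma shift_reflects_eigenspace:
  assumes B: "triangular_basis B lam ord" "span B = UNIV"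
    and v: "T v - l *s v \<in> span {b \<in> B. lam b = l}"
  shows "v \<in> span {b \<in> B. lam b = l}"
proof (rule ccontr)
  let ?V = "{b \<in> B. lam b = l}" and ?r = "representation B"
  note fin = triangular_basisD(1)[OF B(1)] and ind = triangular_basisD(2)[OF B(1)]
  assume nv: "v \<notin> span ?V"
  define S where "S = {b \<in> B. ?r v b \<noteq> 0 \<and> lam b \<noteq> l}"
  have v_sum: "v = (\<Sum>c\<in>B. ?r v c *s c)"
    using sum_representation_eq[of B v B] ind B(2) fin by simp
  have "S \<noteq> {}"
  proof
    assume "S = {}"
    then have "?r v c *s c \<in> span ?V" if "c \<in> B" for c
      using that by (cases "lam c = l") (auto simp: S_def span_zero intro: span_scale span_base)
    then have "v \<in> span ?V" by (subst v_sum) (rule span_sum)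
    then show False using nv by simp
  qed
  moreover have "finite S" using fin by (simp add: S_def)
  ultimately obtain b where b: "b \<in> S" and max: "\<And>c. c \<in> S \<Longrightarrow> ord c \<le> ord b"
    using Max_in[of "ord ` S"] Max_ge[of "ord ` S"] by fastforce
  have bB: "b \<in> B" "lam b \<noteq> l" "?r v b \<noteq> 0" using b by (auto simp: S_def)
  have summand: "?r v c * ?r (T c) b = (if c = b then lam b * ?r v b else 0)" if c: "c \<in> B" for c
  proof (cases "c \<in> S \<or> lam c = l")
    case True
    then show ?thesis
      using representation_triangular[OF B(1) c, of b] max bB by auto
  next
    case False
    then show ?thesis using c b by (auto simp: S_def)
  qed
  have "?r (T v) b = ?r (\<Sum>c\<in>B. ?r v c *s T c) b"
    by (subst v_sum) (simp add: T.sum T.scale)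
  also have "\<dots> = (\<Sum>c\<in>B. ?r v c * ?r (T c) b)"
    using ind B(2) by (simp add: representation_sum representation_scale)
  also have "\<dots> = lam b * ?r v b"
    using fin bB by (simp add: summand)
  finally have "?r (T v - l *s v) b = (lam b - l) * ?r v b"
    using ind B(2) by (simp add: representation_diff representation_scale algebra_simps)
  moreover have "?r (T v - l *s v) b = representation ?V (T v - l *s v) b"
    using representation_extend[OF ind v] by (simp add: subset_iff)
  moreover have "\<dots> = 0" using representation_ne_zero[of ?V _ b] bB by force
  ultimately show False using bB by simp
qed

text \<open>The vectors killed by some power of \<open>T\<close> form a subspace, and with zero
  eigenvalues \<open>T\<close> sends each basis vector into the span of lower ones.\<close>

lemma locally_nilpotent_if_eigenvalues_zero:
  assumes B: "triangular_basis B lam ord" "span B = UNIV" and zero: "\<And>b. b \<in> B \<Longrightarrow> lam b = 0"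
  shows "\<exists>n. (T ^^ n) v = 0"
proof -
  let ?N = "{v. \<exists>n. (T ^^ n) v = 0}"
  have T0: "(T ^^ n) 0 = 0" for n by (induction n) simp_all
  have pow_add: "(T ^^ n) (x + y) = (T ^^ n) x + (T ^^ n) y" for n x y
    by (induction n) (simp_all add: T.add)
  have pow_scale: "(T ^^ n) (c *s x) = c *s (T ^^ n) x" for n c x
    by (induction n) (simp_all add: T.scale)
  have up: "(T ^^ (m + n)) x = 0" if "(T ^^ n) x = 0" for m n x
    using that by (simp add: funpow_add T0)
  have N: "subspace ?N"
  proof (rule subspaceI)
    fix x y assume "x \<in> ?N" "y \<in> ?N"
    then obtain m n where "(T ^^ m) x = 0" "(T ^^ n) y = 0" by blast
    then have "(T ^^ (m + n)) (x + y) = 0"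
      using up[of n y m] up[of m x n] by (simp add: pow_add add.commute)
    then show "x + y \<in> ?N" by blast
  qed (auto simp: T0 pow_scale)
  have "b \<in> ?N" if "b \<in> B" for b
    using that
  proof (induction "ord b" arbitrary: b rule: less_induct)
    case less
    have "T b \<in> span {c \<in> B. ord c < ord b \<and> lam c = lam b}"
      using triangular_basisD(3)[OF B(1) less.prems] zero[OF less.prems] by simp
    moreover have "{c \<in> B. ord c < ord b \<and> lam c = lam b} \<subseteq> ?N" using less by auto
    ultimately have "T b \<in> ?N" using span_minimal[OF _ N] by (meson subsetD)
    then obtain n where "(T ^^ n) (T b) = 0" by blast
    then have "(T ^^ Suc n) b = 0" by (simp add: funpow_swap1)
    then show ?case by blast
  qed
  then have "span B \<subseteq> ?N" by (intro span_minimal N) blast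
  then show ?thesis using B(2) by blast
qed

end

section \<open>Existence of triangular bases over an algebraically closed field\<close>

locale alg_closed_endomorphism = endomorphism scale Basis T
  for scale :: "'a::alg_closed_field \<Rightarrow> 'b::ab_group_add \<Rightarrow> 'b" (infixr \<open>*s\<close> 75)
    and Basis :: "'b set" and T :: "'b \<Rightarrow> 'b"
begin

text \<open>Take a nonzero polynomial p of least degree with p(T) u in \<open>W\<close>. It is not
  constant, hence p = (X - l) q, and by minimality v = q(T) u lies outside \<open>W\<close>.\<close>

lemma ex_eigenvector_modulo:
  assumes W: "subspace W" "W \<noteq> UNIV"
  shows "\<exists>v l. v \<notin> W \<and> T v - l *s v \<in> W"
proof -
  obtain u where u: "u \<notin> W" using W(2) by blast
  let ?P = "\<lambda>p. p \<noteq> 0 \<and> poly_apply p u \<in> W"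
  have "\<exists>p. ?P p" using ex_annihilating_poly[of u] subspace_0[OF W(1)] by metis
  then obtain p0 where "?P p0" by blast
  from ex_has_least_nat[of ?P, OF this, of degree]
  obtain p where p: "?P p" and min: "\<And>q. ?P q \<Longrightarrow> degree p \<le> degree q" by blast
  have "degree p \<noteq> 0"
  proof
    assume "degree p = 0"
    then obtain a where a: "p = [:a:]" by (rule degree_eq_zeroE)
    then have "inverse a *s a *s u \<in> W" using p subspace_scale[OF W(1), of "a *s u" "inverse a"] by simp
    then show False using a p u by simp
  qed
  then obtain l where "poly p l = 0" using alg_closed_imp_poly_has_root by blast
  then obtain q where q: "p = [:- l, 1:] * q" using poly_eq_0_iff_dvd by (metis dvdE)
  then have "q \<noteq> 0" using p by auto
  moreover then have "degree q < degree p" using q by (simp add: degree_mult_eq del: mult_pCons_left)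
  ultimately have "poly_apply q u \<notin> W" using min[of q] by linarith
  moreover have "T (poly_apply q u) - l *s poly_apply q u \<in> W"
    using p poly_apply_linear_factor[of l q u] q by simp
  ultimately show ?thesis by blast
qed

lemma ex_triangular_basis: "\<exists>B lam ord. triangular_basis B lam ord \<and> span B = UNIV"
proof -
  have "\<exists>B lam ord. triangular_basis B lam ord \<and> card B = k" if "k \<le> dimension" for k
    using that
  proof (induction k)
    case 0
    have "triangular_basis {} (\<lambda>_. 0) (\<lambda>_. 0)" by (simp add: triangular_basis_def independent_empty)
    then show ?case by (metis card.empty)
  next
    case (Suc k)
    then obtain B lam ord where B: "triangular_basis B lam ord" "card B = k" by auto
    have "span B \<noteq> UNIV"
      using dim_eq_full[of B] dim_eq_card_independent[OF triangular_basisD(2)[OF B(1)]] B(2) Suc.prems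
      by auto
    then obtain v l where "v \<notin> span B" "T v - l *s v \<in> span B"
      using ex_eigenvector_modulo[of "span B"] by blast
    then obtain v lam' ord' where "v \<notin> B" "triangular_basis (insert v B) lam' ord'"
      using triangular_basis_extend[OF B(1)] by blast
    moreover then have "card (insert v B) = Suc k"
      using B triangular_basisD(1)[OF B(1)] by simp
    ultimately show ?case by blast
  qed
  then obtain B lam ord where B: "triangular_basis B lam ord" "card B = dimension" by blast
  then have "span B = UNIV"
    using dim_eq_full[of B] dim_eq_card_independent[OF triangular_basisD(2)[OF B(1)]] B(2) by simp
  then show ?thesis using B by blast
qed

end

subsection \<open>Engel's theorem\<close>

context leibniz_algebra
begin

section \<open>Bilinearity and the kernel of the map from elements to left multiplications\<close>

lemma bracket_scale_left: "bracket (c *s a) b = c *s bracket a b"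
  using linear_bracket_left[of b] by (simp add: Vector_Spaces.linear_iff)

lemma bracket_scale_right: "bracket a (c *s b) = c *s bracket a b"
  using linear_bracket_right[of a] by (simp add: Vector_Spaces.linear_iff)

lemma bracket_diff_left: "bracket (a - b) c = bracket a c - bracket b c"
  using bracket_add_left[of "a - b" b c] by (simp add: algebra_simps)

lemma bracket_diff_right: "bracket a (b - c) = bracket a b - bracket a c"
  using bracket_add_right[of a "b - c" c] by (simp add: algebra_simps)

lemma bracket_bracket_left: "bracket (bracket a b) c = bracket a (bracket b c) - bracket b (bracket a c)"
  using leibniz[of a b c] by simp

definition left_kernel :: "'b set" where
  "left_kernel = {a. \<forall>b. bracket a b = 0}"

lemma left_kernelD: "a \<in> left_kernel \<Longrightarrow> bracket a b = 0"
  by (simp add: left_kernel_def)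

lemma subspace_left_kernel: "subspace left_kernel"
  by (auto simp: left_kernel_def intro!: subspaceI
      simp: bracket_zero_left bracket_add_left bracket_scale_left)

lemma bracket_left_kernel:
  assumes "k \<in> left_kernel"
  shows "bracket a k \<in> left_kernel"
  using assms by (simp add: left_kernel_def bracket_bracket_left bracket_zero_right)

text \<open>The left multiplication by [a,a] is the commutator of \<open>bracket a\<close> with
  itself.\<close>

lemma Leib_subset_left_kernel: "Leib \<subseteq> left_kernel"
  unfolding Leib_def
  by (intro span_minimal subspace_left_kernel) (auto simp: left_kernel_def bracket_bracket_left)

lemma bracket_self_in_left_kernel: "bracket a a \<in> left_kernel"
  by (simp add: left_kernel_def bracket_bracket_left)

text \<open>The left multiplication by [a,b] is a commutator, so exchanging \<open>a\<close> and
  \<open>b\<close> reverses its sign.\<close>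

lemma bracket_symmetrized_in_left_kernel: "bracket a b + bracket b a \<in> left_kernel"
  by (simp add: left_kernel_def bracket_bracket_left bracket_add_left)

lemma derived_series_Suc_subset:
  assumes "subspace I" "\<And>x y. x \<in> I \<Longrightarrow> y \<in> I \<Longrightarrow> bracket x y \<in> I"
  shows "derived_series I (Suc n) \<subseteq> derived_series I n"
proof (induction n)
  case 0
  show ?case using assms span_minimal[of "{bracket x y | x y. x \<in> I \<and> y \<in> I}" I] by auto
next
  case (Suc n)
  then show ?case unfolding derived_series.simps(2)[of _ "Suc n"] derived_series.simps(2)[of _ n]
    by (intro span_mono) blast
qed

definition left_subalgebra :: "'b set \<Rightarrow> bool" where
  "left_subalgebra H \<longleftrightarrow> subspace H \<and> left_kernel \<subseteq> H \<and> (\<forall>x\<in>H. \<forall>y\<in>H. bracket x y \<in> H)"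

lemma span_insert_subspaceE:
  assumes "subspace M" "x \<in> span (insert z M)"
  obtains i where "x - i *s z \<in> M"
  using assms span_eq_iff[THEN iffD2, of M] by (auto simp: span_breakdown_eq)

text \<open>Both [z,z] and [z,m] + [m,z] lie in the left kernel, hence in \<open>M\<close>. So the
  hypothesis on [m,z] controls [z,m] as well, and all brackets of the larger space even fall into
  \<open>M\<close>.\<close>

lemma left_subalgebra_extend:
  assumes M: "left_subalgebra M" and z: "\<And>m. m \<in> M \<Longrightarrow> bracket m z \<in> M"
  shows "left_subalgebra (span (insert z M))"
proof -
  have sub: "subspace M" and K: "left_kernel \<subseteq> M" and closed: "\<And>x y. x \<in> M \<Longrightarrow> y \<in> M \<Longrightarrow> bracket x y \<in> M"
    using M by (auto simp: left_subalgebra_def)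
  let ?S = "span (insert z M)"
  have MS: "M \<subseteq> ?S" using span_superset[of "insert z M"] by blast
  have zm: "bracket z m \<in> M" if "m \<in> M" for m
    using subspace_diff[OF sub _ z[OF that], of "bracket z m + bracket m z"]
      bracket_symmetrized_in_left_kernel K by auto
  have "bracket x y \<in> M" if xy: "x \<in> ?S" "y \<in> ?S" for x y
  proof -
    obtain i where i: "x - i *s z \<in> M" using xy(1) sub by (blast elim: span_insert_subspaceE)
    obtain j where j: "y - j *s z \<in> M" using xy(2) sub by (blast elim: span_insert_subspaceE)
    let ?m = "x - i *s z" and ?n = "y - j *s z"
    have "bracket x y = bracket (?m + i *s z) (?n + j *s z)" by simp
    also have "\<dots> = bracket ?m ?n + j *s bracket ?m z + (i *s bracket z ?n + i *s j *s bracket z z)"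
      by (simp only: bracket_add_left bracket_add_right bracket_scale_left bracket_scale_right
          scale_right_distrib scale_scale add_ac mult.commute)
    also have "\<dots> \<in> M"
      using closed[OF i j] z[OF i] zm[OF j] bracket_self_in_left_kernel[of z] K
      by (intro subspace_add[OF sub] subspace_scale[OF sub]) auto
    finally show ?thesis .
  qed
  then show ?thesis using MS K by (auto simp: left_subalgebra_def)
qed

end

context finite_dimensional_leibniz_algebra
begin

text \<open>Engel's theorem inside the algebra: adjoining the left kernel to the acting subalgebra makes
  the bracket antisymmetric modulo the subalgebra, so that the induction for Lie algebras applies.\<close>

theorem Engel:
  assumes "left_subalgebra H"
    and "\<And>x v. x \<in> H \<Longrightarrow> \<exists>n. (bracket x ^^ n) v = 0"
    and "subspace U" "\<And>x v. x \<in> H \<Longrightarrow> v \<in> U \<Longrightarrow> bracket x v \<in> U"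
    and "subspace W" "\<And>x v. x \<in> H \<Longrightarrow> v \<in> W \<Longrightarrow> bracket x v \<in> W"
    and "W \<subset> U"
  shows "\<exists>v\<in>U - W. \<forall>x\<in>H. bracket x v \<in> W"
  using assms
proof (induction "dim H" arbitrary: H U W rule: less_induct)
  case less
  note nil = less.prems(2) and W = less.prems(5)
  have H: "subspace H" "left_kernel \<subseteq> H" "\<And>x y. x \<in> H \<Longrightarrow> y \<in> H \<Longrightarrow> bracket x y \<in> H"
    using less.prems(1) by (auto simp: left_subalgebra_def)
  show ?case
  proof (cases "H = left_kernel")
    case True
    then have "\<forall>x\<in>H. bracket x v \<in> W" for v
      using left_kernelD subspace_0[OF W] by metis
    then show ?thesis using less.prems(7) by blast
  next
    case False
    let ?P = "\<lambda>M. left_subalgebra M \<and> M \<subset> H"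
    have "?P left_kernel"
      using False H(2) subspace_left_kernel bracket_left_kernel subspace_0
      by (auto simp: left_subalgebra_def)
    then obtain M where M: "?P M" and max: "\<And>M'. ?P M' \<Longrightarrow> dim M' \<le> dim M"
      using ex_has_greatest_nat[of ?P left_kernel dim "Suc dimension"] dim_subset_UNIV
      by (auto simp: less_Suc_eq_le)
    have Ms: "subspace M" "M \<subseteq> H" "\<And>x y. x \<in> M \<Longrightarrow> y \<in> M \<Longrightarrow> bracket x y \<in> M"
      using M by (auto simp: left_subalgebra_def)
    have dimM: "dim M < dim H"
      using M Ms(1) H(1) subspace_dim_equal[of M H] by fastforce
    \<comment> \<open>Induction with \<open>H\<close> and \<open>M\<close> in the roles of
      \<open>U\<close> and \<open>W\<close>: a vector of \<open>H\<close> killed by \<open>M\<close>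
      modulo \<open>M\<close> normalises \<open>M\<close>. By maximality of \<open>M\<close> it
      spans \<open>H\<close> together with \<open>M\<close>.\<close>
    have "\<exists>v\<in>H - M. \<forall>x\<in>M. bracket x v \<in> M"
      using M Ms H nil by (intro less.hyps[OF dimM]) auto
    then obtain z where z: "z \<in> H" "z \<notin> M" "\<And>m. m \<in> M \<Longrightarrow> bracket m z \<in> M" by blast
    let ?S = "span (insert z M)"
    have "left_subalgebra ?S" using left_subalgebra_extend[OF _ z(3)] M by blast
    moreover have "?S \<subseteq> H" using z(1) Ms(2) H(1) by (intro span_minimal) auto
    moreover have "dim M < dim ?S"
      using z(2) unfolding dim_span dim_insert span_eq_iff[THEN iffD2, OF Ms(1)] by simp
    ultimately have SH: "?S = H" using max[of ?S] by fastforce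
    have "\<exists>v\<in>U - W. \<forall>x\<in>M. bracket x v \<in> W"
      using M Ms less.prems by (intro less.hyps[OF dimM]) auto
    then obtain v where v: "v \<in> U" "v \<notin> W" "\<And>m. m \<in> M \<Longrightarrow> bracket m v \<in> W" by blast
    \<comment> \<open>By [m,[z,w]] = [[m,z],w] + [z,[m,w]], the elements of \<open>M\<close> send
      the whole orbit of \<open>v\<close> under \<open>z\<close> into \<open>W\<close>. As
      \<open>z\<close> is nilpotent, the orbit enters \<open>W\<close>; the last vector before its
      first entry is killed modulo \<open>W\<close> by \<open>z\<close> too.\<close>
    let ?w = "\<lambda>n. (bracket z ^^ n) v"
    have w: "?w n \<in> U \<and> (\<forall>m\<in>M. bracket m (?w n) \<in> W)" for n
    proof (induction n)
      case (Suc n)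
      have "bracket m (bracket z (?w n)) \<in> W" if m: "m \<in> M" for m
        unfolding leibniz[of m z]
        using Suc m z less.prems(6) by (intro subspace_add[OF W]) auto
      then show ?case using Suc less.prems(4) z(1) by simp
    qed (use v in auto)
    have "\<exists>n. ?w n \<in> W" using nil[OF z(1), of v] subspace_0[OF W] by metis
    then obtain n where n: "?w n \<in> W" "\<And>m. m < n \<Longrightarrow> ?w m \<notin> W"
      using exists_least_iff[of "\<lambda>n. ?w n \<in> W"] by blast
    then obtain m where m: "n = Suc m" using v(2) by (cases n) auto
    have "bracket x (?w m) \<in> W" if x: "x \<in> H" for x
    proof -
      obtain i where i: "x - i *s z \<in> M" using x SH Ms(1) by (blast elim: span_insert_subspaceE)
      have "bracket x (?w m) = bracket (x - i *s z) (?w m) + i *s bracket z (?w m)"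
        by (simp add: bracket_diff_left bracket_scale_left)
      then show ?thesis using n(1) m w i by (simp add: subspace_add[OF W] subspace_scale[OF W])
    qed
    then show ?thesis using w n(2)[of m] m by blast
  qed
qed

text \<open>Let \<open>W\<close> be a maximal proper \<open>D\<close>-invariant subspace of
  \<open>D\<close>. Engel gives v outside \<open>W\<close> with [D,v] in \<open>W\<close>, so
  maximality yields D = W + span {v}. Then [D,D] lies in \<open>W\<close>, against
  perfectness.\<close>

lemma perfect_nil_trivial:
  assumes D: "subspace D" "D = span {bracket x y | x y. x \<in> D \<and> y \<in> D}"
    and nil: "\<And>x v. x \<in> D \<Longrightarrow> \<exists>n. (bracket x ^^ n) v = 0"
  shows "D = {0}"
proof (rule ccontr)
  assume "D \<noteq> {0}"
  have closed: "bracket x y \<in> D" if "x \<in> D" "y \<in> D" for x y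
    using that by (subst D(2)) (auto intro: span_base)
  \<comment> \<open>Adding the left kernel makes \<open>D\<close> a \<open>left_subalgebra\<close>
    without adding any new left multiplications.\<close>
  let ?H = "{x + y | x y. x \<in> D \<and> y \<in> left_kernel}"
  have H_act: "\<exists>d\<in>D. bracket x = bracket d" if "x \<in> ?H" for x
    using that by (auto simp: fun_eq_iff bracket_add_left left_kernelD)
  have "subspace ?H" using D(1) subspace_left_kernel by (rule subspace_sums)
  moreover have "left_kernel \<subseteq> ?H" using subspace_0[OF D(1)] by force
  moreover have "bracket x y \<in> ?H" if "x \<in> ?H" "y \<in> ?H" for x y
  proof -
    obtain d where d: "d \<in> D" "bracket x = bracket d" using H_act[OF \<open>x \<in> ?H\<close>] by blast
    obtain e k where "y = e + k" "e \<in> D" "k \<in> left_kernel" using \<open>y \<in> ?H\<close> by blast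
    then show ?thesis
      using d closed[of d e] bracket_left_kernel[of k d] by (auto simp: bracket_add_right)
  qed
  ultimately have H: "left_subalgebra ?H" by (simp add: left_subalgebra_def)
  let ?P = "\<lambda>W. subspace W \<and> W \<subset> D \<and> (\<forall>x\<in>D. \<forall>v\<in>W. bracket x v \<in> W)"
  have "?P {0}"
    using \<open>D \<noteq> {0}\<close> subspace_0[OF D(1)] by (auto simp: bracket_zero_right)
  then obtain W where W: "?P W" and max: "\<And>W'. ?P W' \<Longrightarrow> dim W' \<le> dim W"
    using ex_has_greatest_nat[of ?P "{0}" dim "Suc dimension"] dim_subset_UNIV
    by (auto simp: less_Suc_eq_le)
  have "\<exists>v\<in>D - W. \<forall>x\<in>?H. bracket x v \<in> W"
  proof (rule Engel[OF H])
    show "\<exists>n. (bracket x ^^ n) v = 0" if "x \<in> ?H" for x v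
      using H_act[OF that] nil by metis
    show "bracket x v \<in> D" if "x \<in> ?H" "v \<in> D" for x v
      using H_act[OF that(1)] that(2) closed by metis
    show "bracket x v \<in> W" if "x \<in> ?H" "v \<in> W" for x v
      using H_act[OF that(1)] that(2) W by metis
  qed (use D W in auto)
  moreover have "D \<subseteq> ?H" using subspace_0[OF subspace_left_kernel] by force
  ultimately obtain v where v: "v \<in> D" "v \<notin> W" "\<And>x. x \<in> D \<Longrightarrow> bracket x v \<in> W" by blast
  let ?S = "span (insert v W)"
  have act: "bracket x y \<in> W" if x: "x \<in> D" and y: "y \<in> ?S" for x y
  proof -
    obtain i where i: "y - i *s v \<in> W" using y W by (blast elim: span_insert_subspaceE)
    have "bracket x y = bracket x (y - i *s v) + i *s bracket x v"
      by (simp add: bracket_diff_right bracket_scale_right)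
    then show ?thesis using i x W v(3) by (simp add: subspace_add subspace_scale)
  qed
  have WS: "W \<subseteq> ?S" "v \<in> ?S" using span_superset[of "insert v W"] by auto
  have "dim W < dim ?S"
    using v(2) unfolding dim_span dim_insert span_eq_iff[THEN iffD2, OF conjunct1[OF W]] by simp
  then have "\<not> ?P ?S" using max[of ?S] by linarith
  moreover have "?S \<subseteq> D" using v(1) W D(1) by (intro span_minimal) auto
  moreover have "\<forall>x\<in>D. \<forall>v\<in>?S. bracket x v \<in> ?S" using act WS(1) by (meson subsetD)
  moreover have "subspace ?S" by (rule subspace_span)
  ultimately have "?S = D" by (simp add: psubset_eq)
  then have "{bracket x y | x y. x \<in> D \<and> y \<in> D} \<subseteq> W" using act by blast
  then have "D \<subseteq> W" by (subst D(2), intro span_minimal) (use W in blast)+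
  then show False using W by blast
qed

theorem solvable_if_derived_nil:
  assumes I: "subspace I" "\<And>x y. x \<in> I \<Longrightarrow> y \<in> I \<Longrightarrow> bracket x y \<in> I"
    and nil: "\<And>x v. x \<in> derived_series I (Suc 0) \<Longrightarrow> \<exists>n. (bracket x ^^ n) v = 0"
  shows "solvable I"
proof -
  \<comment> \<open>The series is indexed from [I,I] on, because nilpotence is known only there. A
    term of least dimension equals its successor and is therefore perfect.\<close>
  let ?D = "\<lambda>n. derived_series I (Suc n)"
  have sub: "subspace (?D n)" for n by (rule subspace_derived_series[OF I(1)])
  have dec: "?D (Suc n) \<subseteq> ?D n" for n by (rule derived_series_Suc_subset[OF I])
  obtain n where n: "\<And>m. dim (?D n) \<le> dim (?D m)"
    using ex_has_least_nat[of "\<lambda>_. True" 0 "\<lambda>n. dim (?D n)"] by blast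
  have "?D (Suc n) = ?D n"
    using subspace_dim_equal[OF sub sub dec n] .
  then have perfect: "?D n = span {bracket x y | x y. x \<in> ?D n \<and> y \<in> ?D n}"
    using derived_series.simps(2)[of I "Suc n"] by metis
  have "?D n \<subseteq> ?D 0" by (induction n) (use dec in blast)+
  then have "?D n = {0}"
    using perfect_nil_trivial[OF sub perfect] nil by blast
  then show ?thesis unfolding solvable_def by blast
qed

end

subsection \<open>The trace and the Killing form\<close>

text \<open>Extend \<open>{l}\<close> to a basis of the field over the rationals and take the
  coordinate at \<open>l\<close>.\<close>

lemma ex_rat_linear_functional:
  fixes l :: "'a::field_char_0"
  assumes "l \<noteq> 0"
  obtains f :: "'a \<Rightarrow> rat" where "f l = 1" "\<And>x y. f (x + y) = f x + f y"
    "\<And>q x. f (of_rat q * x) = q * f x"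
proof -
  interpret Q: vector_space "\<lambda>(q::rat) (x::'a). of_rat q * x"
    by unfold_locales (simp_all add: of_rat_add of_rat_mult algebra_simps)
  let ?B = "Q.extend_basis {l}"
  have ind: "Q.independent {l}" using assms by simp
  note B = Q.independent_extend_basis[OF ind] Q.extend_basis_superset[OF ind] Q.span_extend_basis[OF ind]
  show ?thesis
  proof (rule that[of "\<lambda>x. Q.representation ?B x l"])
    show "Q.representation ?B l l = 1"
      using B(2) by (simp add: Q.representation_basis[OF B(1)])
  qed (simp_all add: B Q.representation_add Q.representation_scale)
qed

context finite_dimensional_leibniz_algebra
begin

abbreviation trace :: "('b \<Rightarrow> 'b) \<Rightarrow> 'a" where
  "trace \<equiv> trace_wrt Basis"

lemma trace_add: "trace (\<lambda>v. f v + g v) = trace f + trace g"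
  by (simp add: trace_wrt_def representation_add independent_Basis span_Basis sum.distrib)

lemma trace_diff: "trace (\<lambda>v. f v - g v) = trace f - trace g"
  by (simp add: trace_wrt_def representation_diff independent_Basis span_Basis sum_subtractf)

lemma trace_scale: "trace (\<lambda>v. c *s f v) = c * trace f"
  by (simp add: trace_wrt_def representation_scale independent_Basis span_Basis sum_distrib_left)

lemma trace_compose_commute:
  assumes "Vector_Spaces.linear scale scale f" "Vector_Spaces.linear scale scale g"
  shows "trace (\<lambda>v. f (g v)) = trace (\<lambda>v. g (f v))"
proof -
  let ?r = "representation Basis"
  have expand: "trace (\<lambda>v. h (k v)) = (\<Sum>b\<in>Basis. \<Sum>c\<in>Basis. ?r (k b) c * ?r (h c) b)"
    if "Vector_Spaces.linear scale scale h" for h k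
  proof -
    interpret h: Vector_Spaces.linear scale scale h by (rule that)
    have "?r (h (k b)) b = (\<Sum>c\<in>Basis. ?r (k b) c * ?r (h c) b)" for b
    proof -
      have "h (k b) = h (\<Sum>c\<in>Basis. ?r (k b) c *s c)"
        using sum_representation_eq[of Basis "k b" Basis]
        by (simp add: independent_Basis span_Basis finite_Basis)
      also have "\<dots> = (\<Sum>c\<in>Basis. ?r (k b) c *s h c)"
        by (simp add: h.sum h.scale)
      finally show ?thesis
        by (simp add: representation_sum representation_scale independent_Basis span_Basis)
    qed
    then show ?thesis by (simp add: trace_wrt_def)
  qed
  show ?thesis
    unfolding expand[OF assms(1)] expand[OF assms(2)] by (subst sum.swap) (simp add: mult.commute)
qed

text \<open>Cyclicity of the trace moves the commutator from the pair \<open>a\<close>,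
  \<open>b\<close> to the pair \<open>b\<close>, \<open>y\<close>. For \<open>y\<close> a left
  multiplication this is invariance of the Killing form; for \<open>y\<close> a derivation it serves
  to test [I,I].\<close>

lemma trace_commutator_left:
  assumes "Vector_Spaces.linear scale scale y"
  shows "trace (\<lambda>v. bracket (bracket a b) (y v))
    = trace (\<lambda>v. bracket a (bracket b (y v) - y (bracket b v)))"
proof -
  have "Vector_Spaces.linear scale scale (\<lambda>v. bracket a (y v))"
    using Vector_Spaces.linear_compose[OF assms linear_bracket_right[of a]] by (simp add: o_def)
  from trace_compose_commute[OF linear_bracket_right[of b] this]
  show ?thesis by (simp add: bracket_bracket_left bracket_diff_right trace_diff)
qed

section \<open>Invariance of the Killing form and its radical as an ideal\<close>

lemma killing_form_bracket_left: "killing_form (bracket b c) a = killing_form b (bracket c a)"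
  using trace_commutator_left[OF linear_bracket_right[of a], of b c]
  by (simp add: killing_form_def o_def bracket_bracket_left)

lemma killing_form_add_left: "killing_form (x + y) a = killing_form x a + killing_form y a"
  by (simp add: killing_form_def o_def bracket_add_left trace_add)

lemma killing_form_scale_left: "killing_form (c *s x) a = c * killing_form x a"
  by (simp add: killing_form_def o_def bracket_scale_left trace_scale)

lemma killing_form_bracket_swap: "killing_form (bracket c b) a = - killing_form b (bracket c a)"
proof -
  have "bracket (bracket c b) v = (- 1) *s bracket (bracket b c) v" for v
    by (simp add: bracket_bracket_left)
  then have "killing_form (bracket c b) a = - killing_form (bracket b c) a"
    by (simp only: killing_form_def o_def trace_scale) simp
  then show ?thesis by (simp only: killing_form_bracket_left)
qed

lemma is_ideal_killing_radical: "is_ideal killing_radical"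
  unfolding is_ideal_def
proof (intro conjI allI ballI)
  show "subspace killing_radical"
    using killing_form_scale_left[of 0 0]
    by (auto intro!: subspaceI simp: killing_radical_def killing_form_add_left killing_form_scale_left)
  fix a x assume x: "x \<in> killing_radical"
  then show "bracket a x \<in> killing_radical"
    by (simp add: killing_radical_def killing_form_bracket_swap)
  show "bracket x a \<in> killing_radical"
    using x by (simp add: killing_radical_def killing_form_bracket_left)
qed

lemma Leib_subset_killing_radical: "Leib \<subseteq> killing_radical"
proof
  fix x assume "x \<in> Leib"
  then have "bracket x = (\<lambda>_. 0)"
    using Leib_subset_left_kernel left_kernelD by blast
  then show "x \<in> killing_radical"
    using trace_scale[of 0 "\<lambda>_. 0"] by (simp add: killing_radical_def killing_form_def o_def)
qed

end

subsection \<open>Solvability of the Killing radical\<close>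

locale alg_closed_leibniz_algebra = finite_dimensional_leibniz_algebra scale bracket Basis
  for scale :: "'a::{alg_closed_field, field_char_0} \<Rightarrow> 'b::ab_group_add \<Rightarrow> 'b" (infixr \<open>*s\<close> 75)
    and bracket :: "'b \<Rightarrow> 'b \<Rightarrow> 'b"
    and Basis :: "'b set"
begin

lemma alg_closed_endomorphism_bracket: "alg_closed_endomorphism scale Basis (bracket x)"
  unfolding alg_closed_endomorphism_def endomorphism_def
  using linear_bracket_right finite_dimensional_vector_space_axioms by blast

text \<open>The test derivation acts on the generalised \<open>l\<close>-eigenspace as \<open>f l\<close>, where \<open>f\<close> is a
  \<open>\<rat>\<close>-linear functional on the field; rationality makes the resulting sum of squares definite.\<close>

lemma bracket_nilpotent_if_trace_derivations_zero:
  assumes zero: "\<And>y. Vector_Spaces.linear scale scale y \<Longrightarrow>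
      (\<And>u v. y (bracket u v) = bracket (y u) v + bracket u (y v)) \<Longrightarrow>
      trace (\<lambda>v. bracket x (y v)) = 0"
  shows "\<exists>n. (bracket x ^^ n) v = 0"
proof -
  interpret T: alg_closed_endomorphism scale Basis "bracket x" by (rule alg_closed_endomorphism_bracket)
  obtain B lam ord where tri: "T.triangular_basis B lam ord" and spn: "span B = UNIV"
    using T.ex_triangular_basis by blast
  note B = T.triangular_basisD(1,2)[OF tri] spn
  let ?V = "\<lambda>l. span {b \<in> B. lam b = l}"
  \<comment> \<open>Generalised eigenspaces multiply additively: with T = \<open>bracket x\<close>,
    the Leibniz identity gives (T - l - m)[b,c] = [(T - l)b, c] + [b, (T - m)c]. The right side has
    lower total order, and T - l - m reflects membership in the block of l + m.\<close>
  have bracket_eigenspaces: "bracket b c \<in> ?V (lam b + lam c)" if "b \<in> B" "c \<in> B" for b c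
    using that
  proof (induction "ord b + ord c" arbitrary: b c rule: less_induct)
    case less
    let ?s = "lam b + lam c"
    let ?low = "\<lambda>b. {c \<in> B. ord c < ord b \<and> lam c = lam b}"
    have "bracket u c \<in> ?V ?s" if "u \<in> span (?low b)" for u
      using that
    proof (induction rule: span_induct)
      case base
      show ?case
        by (rule subspaceI)
          (simp_all add: bracket_zero_left bracket_add_left bracket_scale_left span_zero span_add span_scale)
    next
      case (step a)
      then show ?case using less.hyps[of a c] less.prems by simp
    qed
    moreover have "bracket b u \<in> ?V ?s" if "u \<in> span (?low c)" for u
      using that
    proof (induction rule: span_induct)
      case base
      show ?case
        by (rule subspaceI)
          (simp_all add: bracket_zero_right bracket_add_right bracket_scale_right span_zero span_add span_scale)
    next
      case (step a)
      then show ?case using less.hyps[of b a] less.prems by simp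
    qed
    ultimately have "bracket (bracket x b - lam b *s b) c + bracket b (bracket x c - lam c *s c) \<in> ?V ?s"
      using T.triangular_basisD(3)[OF tri] less.prems by (simp add: span_add)
    moreover have "bracket (bracket x b - lam b *s b) c + bracket b (bracket x c - lam c *s c)
        = bracket x (bracket b c) - ?s *s bracket b c"
      by (simp add: leibniz[of x] bracket_diff_left bracket_diff_right bracket_scale_left
          bracket_scale_right algebra_simps)
    ultimately have "bracket x (bracket b c) - ?s *s bracket b c \<in> ?V ?s" by (simp only:)
    then show ?case by (rule T.shift_reflects_eigenspace[OF tri spn])
  qed
  have "lam b = 0" if b: "b \<in> B" for b
  proof (rule ccontr)
    assume "lam b \<noteq> 0"
    then obtain f :: "'a \<Rightarrow> rat" where f: "f (lam b) = 1" "\<And>x y. f (x + y) = f x + f y"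
      "\<And>q x. f (of_rat q * x) = q * f x" by (rule ex_rat_linear_functional) (rule that)
    interpret vector_space_pair scale scale ..
    define y where "y = construct B (\<lambda>b. of_rat (f (lam b)) *s b)"
    have y_lin: "Vector_Spaces.linear scale scale y"
      unfolding y_def by (rule linear_construct[OF B(2)])
    interpret y: Vector_Spaces.linear scale scale y by (rule y_lin)
    have y_basis: "y b = of_rat (f (lam b)) *s b" if "b \<in> B" for b
      unfolding y_def using construct_basis[OF B(2) that] .
    have y_eigenspace: "y v = of_rat (f l) *s v" if "v \<in> ?V l" for v l
      using that
    proof (induction rule: span_induct)
      case base
      show ?case by (rule subspaceI) (simp_all add: y.add y.scale algebra_simps)
    qed (auto simp: y_basis)
    \<comment> \<open>Both sides are [u,v] times a scalar: f(l + m) on the left by the grading, f(l)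
      + f(m) on the right.\<close>
    have der_basis: "y (bracket u v) = bracket (y u) v + bracket u (y v)" if "u \<in> B" "v \<in> B" for u v
      using y_eigenspace[OF bracket_eigenspaces[OF that]] that
      by (simp add: y_basis f(2) of_rat_add bracket_scale_left bracket_scale_right algebra_simps)
    have der_left: "y (bracket u v) = bracket (y u) v + bracket u (y v)" if "v \<in> B" for u v
    proof -
      have "u \<in> span B" using spn by simp
      then show ?thesis
      proof (induction rule: span_induct)
        case base
        show ?case
          by (rule subspaceI)
            (simp_all add: y.add y.scale bracket_zero_left bracket_add_left bracket_scale_left algebra_simps)
      qed (use der_basis that in auto)
    qed
    have der: "y (bracket u v) = bracket (y u) v + bracket u (y v)" for u v
    proof -
      have "v \<in> span B" using spn by simp
      then show ?thesis
      proof (induction rule: span_induct)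
        case base
        show ?case
          by (rule subspaceI)
            (simp_all add: y.add y.scale bracket_zero_right bracket_add_right bracket_scale_right algebra_simps)
      qed (use der_left in auto)
    qed
    have diag: "representation B (bracket x (y c)) c = of_rat (f (lam c)) * lam c" if c: "c \<in> B" for c
      using c T.representation_triangular[OF tri c, of c]
      by (simp add: y_basis bracket_scale_right representation_scale[OF B(2)] spn)
    have lin: "Vector_Spaces.linear scale scale (\<lambda>v. bracket x (y v))"
      using Vector_Spaces.linear_compose[OF y_lin linear_bracket_right[of x]] by (simp add: o_def)
    have "0 = trace (\<lambda>v. bracket x (y v))"
      using zero[OF y_lin der] by simp
    also have "\<dots> = trace_wrt B (\<lambda>v. bracket x (y v))"
      by (intro trace_wrt_basis_independent lin finite_Basis independent_Basis span_Basis B)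
    also have "\<dots> = (\<Sum>c\<in>B. of_rat (f (lam c)) * lam c)"
      by (simp add: trace_wrt_def diag)
    \<comment> \<open>Here \<open>f\<close> turns the rational factor \<open>f (lam c)\<close> times
      \<open>lam c\<close> into a square. Since these squares are rational, a vanishing sum forces
      each of them to vanish, against \<open>f (lam b) = 1\<close>.\<close>
    finally have "f (\<Sum>c\<in>B. of_rat (f (lam c)) * lam c) = 0"
      using f(3)[of 0 0] by simp
    moreover have "f (\<Sum>c\<in>C. g c) = (\<Sum>c\<in>C. f (g c))" for g and C :: "'b set"
      by (induction C rule: infinite_finite_induct) (use f(2) f(3)[of 0 0] in simp_all)
    ultimately have "(\<Sum>c\<in>B. f (lam c) * f (lam c)) = 0"
      by (simp add: f(3))
    then have "f (lam b) * f (lam b) = 0"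
      using b B(1) by (subst (asm) sum_nonneg_eq_0_iff) auto
    then show False using f(1) by simp
  qed
  then show ?thesis
    using T.locally_nilpotent_if_eigenvalues_zero[OF tri spn] by blast
qed

lemma solvable_killing_radical: "solvable killing_radical"
proof -
  have I: "subspace killing_radical" "\<And>a x. x \<in> killing_radical \<Longrightarrow> bracket a x \<in> killing_radical"
    using is_ideal_killing_radical by (auto simp: is_ideal_def)
  show ?thesis
  proof (rule solvable_if_derived_nil[OF I(1)])
    fix x v assume x: "x \<in> derived_series killing_radical (Suc 0)"
    show "\<exists>n. (bracket x ^^ n) v = 0"
    proof (rule bracket_nilpotent_if_trace_derivations_zero)
      fix y assume y: "Vector_Spaces.linear scale scale y"
        "\<And>u v. y (bracket u v) = bracket (y u) v + bracket u (y v)"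
      have "x \<in> span {bracket u v | u v. u \<in> killing_radical \<and> v \<in> killing_radical}"
        using x by simp
      then show "trace (\<lambda>v. bracket x (y v)) = 0"
      proof (induction rule: span_induct)
        case base
        show ?case
          using trace_scale[of 0 "\<lambda>_. 0"]
          by (auto intro!: subspaceI simp: bracket_zero_left bracket_add_left bracket_scale_left
              trace_add trace_scale)
      next
        case (step a)
        then obtain u w where a: "a = bracket u w" "u \<in> killing_radical" by blast
        \<comment> \<open>The derivation rule says that the commutator of \<open>bracket w\<close>
          with \<open>y\<close> is minus the left multiplication by \<open>y w\<close>; the trace
          thus becomes a value of the Killing form at \<open>u\<close>.\<close>
        have "bracket u (bracket w (y v) - y (bracket w v)) = (- 1) *s bracket u (bracket (y w) v)" for v
          using y(2)[of w v] bracket_scale_right[of u "- 1"] by simp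
        then have "trace (\<lambda>v. bracket a (y v)) = (- 1) * killing_form u (y w)"
          unfolding a(1) trace_commutator_left[OF y(1)]
          by (simp only: trace_scale killing_form_def o_def)
        then show ?case using a(2) by (simp add: killing_radical_def)
      qed
    qed
  qed (rule I(2))
qed

theorem killing_nondegenerate_if_semisimple:
  assumes semisimple
  shows killing_nondegenerate
proof -
  have "killing_radical \<subseteq> rad"
    using rad_greatest is_ideal_killing_radical solvable_killing_radical by blast
  then show ?thesis
    using assms Leib_subset_killing_radical by (auto simp: semisimple_def killing_nondegenerate_def)
qed

end

theorem theorem5p8:
  fixes scale :: "'a::{alg_closed_field, field_char_0} \<Rightarrow> 'b::ab_group_add \<Rightarrow> 'b"
    and bracket :: "'b \<Rightarrow> 'b \<Rightarrow> 'b"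
    and Basis :: "'b set"
  assumes "finite_dimensional_leibniz_algebra scale bracket Basis"
    and "leibniz_algebra.semisimple scale bracket"
  shows "finite_dimensional_leibniz_algebra.killing_nondegenerate scale bracket Basis"
proof -
  interpret alg_closed_leibniz_algebra scale bracket Basis
    using assms(1) by (simp add: alg_closed_leibniz_algebra_def)
  show ?thesis using assms(2) by (rule killing_nondegenerate_if_semisimple)
qed

end
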